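(* A displacement field $\mathbf{u}:\Omega\to\mathbb{R}^3$ is universal for the monoclinic class $\mathbb{Z}_2^-$ of linear strain-gradient elastic solids if and only if it is the superposition (sum) of a homogeneous displacement field and a field $(c\,x_2x_3,\,-c\,x_1x_3,\,0)$ for some constant $c\in\mathbb{R}$.
   Context: $\Omega\subset\mathbb{R}^3$ is a nonempty convex open set with Cartesian coordinates $(x_1,x_2,x_3)$ and orthonormal basis $e_1,e_2,e_3$. Repeated indices are summed over $1,2,3$ and a comma denotes partial differentiation. A displacement field is a smooth map $\mathbf{u}:\Omega\to\mathbb{R}^3$, with strain $e_{lm}=\tfrac12(u_{l,m}+u_{m,l})$. It is homogeneous if $\mathbf{u}(\mathbf{x})=\mathbf{H}\mathbf{x}+\mathbf{b}$ for a constant matrix $\mathbf{H}$ and constant vector $\mathbf{b}$. A strain-gradient material is a triple $(\mathsf{C},\mathsf{M},\mathsf{A})$ of constant real tensors of orders $4,5,6$ with index symmetries $\mathsf{C}_{ijlm}=\mathsf{C}_{jilm}=\mathsf{C}_{lmij}$, $\mathsf{M}_{ijklm}=\mathsf{M}_{jiklm}=\mathsf{M}_{ijlkm}$, $\mathsf{A}_{ijklmn}=\mathsf{A}_{jiklmn}=\mathsf{A}_{lmnijk}$. Its stress and hyper-stress are $\sigma_{ij}=\mathsf{C}_{ijlm}e_{lm}+\mathsf{M}_{ijlmn}e_{lm,n}$ and $\tau_{ijk}=\mathsf{M}_{lmijk}e_{lm}+\mathsf{A}_{ijklmn}e_{lm,n}$, and the equilibrium equations without body forces are $\sigma_{ij,j}-\tau_{ijk,jk}=0$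 in $\Omega$ for $i=1,2,3$. For a subgroup $G\subset \mathrm{O}(3)$, a tensor $T$ of order $p$ is $G$-invariant if $Q_{i_1j_1}\cdots Q_{i_pj_p}T_{j_1\dots j_p}=T_{i_1\dots i_p}$ for all $Q\in G$. $\mathbb{Z}_2^-$ is the group generated by the reflection $x_3\mapsto -x_3$; $\mathbb{Z}_2$ is the group generated by the rotation by $\pi$ about $e_3$, $\mathbb{Z}_2^c=\{I,-I\}$, and $\mathbb{Z}_2\oplus\mathbb{Z}_2^c$ is the group generated by both. The monoclinic class $\mathbb{Z}_2^-$ is the set of all materials with $\mathsf{C}$ and $\mathsf{A}$ $\mathbb{Z}_2\oplus\mathbb{Z}_2^c$-invariant (13 and 91 independent constants) and $\mathsf{M}$ $\mathbb{Z}_2^-$-invariant (56 independent constants). A displacement field is universal for the class if it satisfies the equilibrium equations for every material in the class. *)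

theory Defs
  imports "HOL-Analysis.Analysis" "HOL-Algebra.Generated_Groups"
begin

(* Indices range over the type 3, whose elements are 1, 2 and 3 (= 0). *)

type_synonym tensor4 = "3 \<Rightarrow> 3 \<Rightarrow> 3 \<Rightarrow> 3 \<Rightarrow> real"
type_synonym tensor5 = "3 \<Rightarrow> 3 \<Rightarrow> 3 \<Rightarrow> 3 \<Rightarrow> 3 \<Rightarrow> real"
type_synonym tensor6 = "3 \<Rightarrow> 3 \<Rightarrow> 3 \<Rightarrow> 3 \<Rightarrow> 3 \<Rightarrow> 3 \<Rightarrow> real"

primrec Ck_on ::
  "nat \<Rightarrow> ('a::real_normed_vector \<Rightarrow> 'b::real_normed_vector) \<Rightarrow> 'a set \<Rightarrow> bool" where
  "Ck_on 0 f S \<longleftrightarrow> continuous_on S f"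
| "Ck_on (Suc k) f S \<longleftrightarrow>
     (\<forall>x\<in>S. f differentiable at x) \<and> (\<forall>v. Ck_on k (\<lambda>x. frechet_derivative f (at x) v) S)"

(* A field on \<Omega> is a total function, of which only the values on the open set \<Omega> matter. *)
definition displacement_field :: "(real^3) set \<Rightarrow> (real^3 \<Rightarrow> real^3) \<Rightarrow> bool" where
  "displacement_field \<Omega> u \<longleftrightarrow> (\<forall>k. Ck_on k u \<Omega>)"

definition homogeneous_field :: "(real^3) set \<Rightarrow> (real^3 \<Rightarrow> real^3) \<Rightarrow> bool" where
  "homogeneous_field \<Omega> u \<longleftrightarrow> (\<exists>(H::real^3^3) b. \<forall>x\<in>\<Omega>. u x = H *v x + b)"

definition partial :: "3 \<Rightarrow> (real^3 \<Rightarrow> real) \<Rightarrow> real^3 \<Rightarrow> real" where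
  "partial k f x = frechet_derivative f (at x) (axis k 1)"

definition strain :: "(real^3 \<Rightarrow> real^3) \<Rightarrow> 3 \<Rightarrow> 3 \<Rightarrow> real^3 \<Rightarrow> real" where
  "strain u l m x = (partial m (\<lambda>y. u y $ l) x + partial l (\<lambda>y. u y $ m) x) / 2"

definition strain_gradient_material :: "tensor4 \<times> tensor5 \<times> tensor6 \<Rightarrow> bool" where
  "strain_gradient_material = (\<lambda>(C, M, A).
     (\<forall>i j l m. C i j l m = C j i l m \<and> C i j l m = C l m i j) \<and>
     (\<forall>i j k l m. M i j k l m = M j i k l m \<and> M i j k l m = M i j l k m) \<and>
     (\<forall>i j k l m n. A i j k l m n = A j i k l m n \<and> A i j k l m n = A l m n i j k))"

definition stress ::
  "tensor4 \<Rightarrow> tensor5 \<Rightarrow> (real^3 \<Rightarrow> real^3) \<Rightarrow> 3 \<Rightarrow> 3 \<Rightarrow> real^3 \<Rightarrow> real" where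
  "stress C M u i j x =
     (\<Sum>l\<in>UNIV. \<Sum>m\<in>UNIV. C i j l m * strain u l m x) +
     (\<Sum>l\<in>UNIV. \<Sum>m\<in>UNIV. \<Sum>n\<in>UNIV. M i j l m n * partial n (strain u l m) x)"

definition hyperstress ::
  "tensor5 \<Rightarrow> tensor6 \<Rightarrow> (real^3 \<Rightarrow> real^3) \<Rightarrow> 3 \<Rightarrow> 3 \<Rightarrow> 3 \<Rightarrow> real^3 \<Rightarrow> real" where
  "hyperstress M A u i j k x =
     (\<Sum>l\<in>UNIV. \<Sum>m\<in>UNIV. M l m i j k * strain u l m x) +
     (\<Sum>l\<in>UNIV. \<Sum>m\<in>UNIV. \<Sum>n\<in>UNIV. A i j k l m n * partial n (strain u l m) x)"

definition equilibrium ::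
  "(real^3) set \<Rightarrow> tensor4 \<times> tensor5 \<times> tensor6 \<Rightarrow> (real^3 \<Rightarrow> real^3) \<Rightarrow> bool" where
  "equilibrium \<Omega> = (\<lambda>(C, M, A) u. \<forall>x\<in>\<Omega>. \<forall>i.
     (\<Sum>j\<in>UNIV. partial j (stress C M u i j) x) -
     (\<Sum>j\<in>UNIV. \<Sum>k\<in>UNIV. partial k (partial j (hyperstress M A u i j k)) x) = 0)"

definition O3 :: "(real^3^3) monoid" where
  "O3 = \<lparr>carrier = {Q. orthogonal_matrix Q}, mult = (**), one = mat 1\<rparr>"

lemma group_O3: "group O3"
proof (rule groupI)
  fix Q assume "Q \<in> carrier O3"
  then show "\<exists>P\<in>carrier O3. P \<otimes>\<^bsub>O3\<^esub> Q = \<one>\<^bsub>O3\<^esub>"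
    by (intro bexI[of _ "transpose Q"]) (auto simp: O3_def orthogonal_matrix_def)
qed (auto simp: O3_def orthogonal_matrix_mul orthogonal_matrix_id matrix_mul_assoc)

definition reflection_e3 :: "real^3^3" where
  "reflection_e3 = vector [vector [1, 0, 0], vector [0, 1, 0], vector [0, 0, -1]]"

definition rotation_pi_e3 :: "real^3^3" where
  "rotation_pi_e3 = vector [vector [-1, 0, 0], vector [0, -1, 0], vector [0, 0, 1]]"

definition Z2_minus :: "(real^3^3) set" where
  "Z2_minus = generate O3 {reflection_e3}"

definition Z2_plus_Z2c :: "(real^3^3) set" where
  "Z2_plus_Z2c = generate O3 {rotation_pi_e3, - mat 1}"

definition invariant4 :: "(real^3^3) set \<Rightarrow> tensor4 \<Rightarrow> bool" where
  "invariant4 G T \<longleftrightarrow> (\<forall>Q\<in>G. \<forall>i1 i2 i3 i4.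
     (\<Sum>j1\<in>UNIV. \<Sum>j2\<in>UNIV. \<Sum>j3\<in>UNIV. \<Sum>j4\<in>UNIV.
        Q$i1$j1 * Q$i2$j2 * Q$i3$j3 * Q$i4$j4 * T j1 j2 j3 j4) = T i1 i2 i3 i4)"

definition invariant5 :: "(real^3^3) set \<Rightarrow> tensor5 \<Rightarrow> bool" where
  "invariant5 G T \<longleftrightarrow> (\<forall>Q\<in>G. \<forall>i1 i2 i3 i4 i5.
     (\<Sum>j1\<in>UNIV. \<Sum>j2\<in>UNIV. \<Sum>j3\<in>UNIV. \<Sum>j4\<in>UNIV. \<Sum>j5\<in>UNIV.
        Q$i1$j1 * Q$i2$j2 * Q$i3$j3 * Q$i4$j4 * Q$i5$j5 * T j1 j2 j3 j4 j5) = T i1 i2 i3 i4 i5)"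

definition invariant6 :: "(real^3^3) set \<Rightarrow> tensor6 \<Rightarrow> bool" where
  "invariant6 G T \<longleftrightarrow> (\<forall>Q\<in>G. \<forall>i1 i2 i3 i4 i5 i6.
     (\<Sum>j1\<in>UNIV. \<Sum>j2\<in>UNIV. \<Sum>j3\<in>UNIV. \<Sum>j4\<in>UNIV. \<Sum>j5\<in>UNIV. \<Sum>j6\<in>UNIV.
        Q$i1$j1 * Q$i2$j2 * Q$i3$j3 * Q$i4$j4 * Q$i5$j5 * Q$i6$j6 * T j1 j2 j3 j4 j5 j6)
     = T i1 i2 i3 i4 i5 i6)"

definition monoclinic_Z2_minus :: "(tensor4 \<times> tensor5 \<times> tensor6) set" where
  "monoclinic_Z2_minus = {(C, M, A).
     strain_gradient_material (C, M, A) \<and>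
     invariant4 Z2_plus_Z2c C \<and> invariant5 Z2_minus M \<and> invariant6 Z2_plus_Z2c A}"

definition universal_for ::
  "(real^3) set \<Rightarrow> (tensor4 \<times> tensor5 \<times> tensor6) set \<Rightarrow> (real^3 \<Rightarrow> real^3) \<Rightarrow> bool" where
  "universal_for \<Omega> K u \<longleftrightarrow> (\<forall>P\<in>K. equilibrium \<Omega> P u)"

end

theory Submission
  imports Defs
begin

text \<open>
  Taking $M = 0$, $A = 0$ and $C$ the symmetrized product of two symmetric matrices of the same
  parity in the index 3 turns universality into linear equations for the strain gradient
  $e_{lm,n}$ at each point. Their only solutions are the multiples of one tensor, supported on
  $e_{13,2} = - e_{23,1}$. Since mixed partial derivatives commute, the factor is constant on the
  convex domain. The formula $u_{i,jk} = e_{ij,k} + e_{ik,j} - e_{jk,i}$ then gives constant second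
  derivatives of $u$, and two integrations recover $u$ up to an affine map. Conversely,
  for a constant strain gradient all contributions of $M$ and $A$ to the equilibrium equations vanish,
  and the symmetries of $C$ remove the rest.
\<close>

subsection \<open>Smooth functions and partial derivatives\<close>

text \<open>The condition of \<open>displacement_field\<close> for arbitrary spaces, so that it also
  covers components, partial derivatives and strains.\<close>

definition smooth_on :: "('a::real_normed_vector \<Rightarrow> 'b::real_normed_vector) \<Rightarrow> 'a set \<Rightarrow> bool" where
  "smooth_on f S \<longleftrightarrow> (\<forall>k. Ck_on k f S)"

lemma smooth_on_differentiable: "smooth_on f S \<Longrightarrow> x \<in> S \<Longrightarrow> f differentiable at x"
  using Ck_on.simps(2) unfolding smooth_on_def by blast

lemma smooth_on_frechet_derivative:
  "smooth_on f S \<Longrightarrow> smooth_on (\<lambda>x. frechet_derivative f (at x) v) S"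
  using Ck_on.simps(2) unfolding smooth_on_def by blast

lemma smooth_on_continuous: "smooth_on f S \<Longrightarrow> continuous_on S f"
  using Ck_on.simps(1) unfolding smooth_on_def by blast

text \<open>On an open set the derivative at a point depends only on nearby values inside the set.
  This permits replacing the Frechet derivative of a compound function by a formula that is known on
  \<open>S\<close> only.\<close>

lemma Ck_on_cong:
  assumes "open S" "\<And>x. x \<in> S \<Longrightarrow> f x = g x" "Ck_on k f S"
  shows "Ck_on k g S"
  using assms(2,3)
proof (induction k arbitrary: f g)
  case 0
  then show ?case by (metis Ck_on.simps(1) continuous_on_cong)
next
  case (Suc k)
  have f: "f differentiable at x" if "x \<in> S" for x
    using Suc.prems(2) that by simp
  have "frechet_derivative f (at x) = frechet_derivative g (at x)" if "x \<in> S" for x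
    using frechet_derivative_transform_within_open[OF f assms(1)] that Suc.prems(1) by blast
  then have "Ck_on k (\<lambda>x. frechet_derivative g (at x) v) S" for v
    using Suc.IH[of "\<lambda>x. frechet_derivative f (at x) v"] Suc.prems(2) by simp
  moreover have "g differentiable at x" if "x \<in> S" for x
    using f[OF that] Suc.prems(1) that assms(1)
    by (meson differentiable_def has_derivative_transform_within_open)
  ultimately show ?case by simp
qed

text \<open>The derivative of \<open>L\<close> after \<open>f\<close> is \<open>L\<close> after the
  derivative of \<open>f\<close>, which has the same shape, so the induction on \<open>k\<close>
  closes with \<open>f\<close> arbitrary.\<close>

lemma Ck_on_bounded_linear:
  assumes "open S" "bounded_linear L" "Ck_on k f S"
  shows "Ck_on k (\<lambda>x. L (f x)) S"
  using assms(3)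
proof (induction k arbitrary: f)
  case 0
  then show ?case using assms(2) by (simp add: bounded_linear.continuous_on)
next
  case (Suc k)
  have D: "((\<lambda>x. L (f x)) has_derivative (\<lambda>v. L (frechet_derivative f (at x) v))) (at x)"
    if "x \<in> S" for x
    using Suc.prems that
    by (auto intro!: bounded_linear.has_derivative[OF assms(2)] simp: frechet_derivative_works[symmetric])
  have "Ck_on k (\<lambda>x. frechet_derivative (\<lambda>x. L (f x)) (at x) v) S" for v
    by (rule Ck_on_cong[OF assms(1), of "\<lambda>x. L (frechet_derivative f (at x) v)"])
      (use Suc frechet_derivative_at[OF D] in \<open>auto dest: fun_cong\<close>)
  with D show ?case by (auto simp: differentiable_def)
qed

lemma Ck_on_add:
  assumes "open S" "Ck_on k f S" "Ck_on k g S"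
  shows "Ck_on k (\<lambda>x. f x + g x) S"
  using assms(2,3)
proof (induction k arbitrary: f g)
  case 0
  then show ?case by (simp add: continuous_on_add)
next
  case (Suc k)
  have D: "((\<lambda>x. f x + g x) has_derivative
      (\<lambda>v. frechet_derivative f (at x) v + frechet_derivative g (at x) v)) (at x)"
    if "x \<in> S" for x
    using Suc.prems that
    by (auto intro!: has_derivative_add simp: frechet_derivative_works[symmetric])
  have "Ck_on k (\<lambda>x. frechet_derivative (\<lambda>x. f x + g x) (at x) v) S" for v
    by (rule Ck_on_cong[OF assms(1), of
          "\<lambda>x. frechet_derivative f (at x) v + frechet_derivative g (at x) v"])
      (use Suc frechet_derivative_at[OF D] in \<open>auto dest: fun_cong\<close>)
  with D show ?case by (auto simp: differentiable_def)
qed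

lemma smooth_on_partial: "smooth_on f S \<Longrightarrow> smooth_on (partial k f) S"
  unfolding partial_def by (rule smooth_on_frechet_derivative)

lemma smooth_on_component:
  "open S \<Longrightarrow> smooth_on u S \<Longrightarrow> smooth_on (\<lambda>x. u x $ l) S"
  unfolding smooth_on_def using Ck_on_bounded_linear[OF _ bounded_linear_vec_nth] by blast

lemma smooth_on_strain:
  assumes "open S" "smooth_on u S"
  shows "smooth_on (strain u l m) S"
proof -
  note smooth = smooth_on_partial[OF smooth_on_component[OF assms]]
  have "Ck_on k (\<lambda>x. (partial m (\<lambda>y. u y $ l) x + partial l (\<lambda>y. u y $ m) x) / 2) S" for k
    using smooth
    by (intro Ck_on_bounded_linear[OF assms(1), of "\<lambda>t. t / 2"] Ck_on_add assms(1))
      (auto simp: smooth_on_def bounded_linear_divide)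
  then show ?thesis
    unfolding smooth_on_def strain_def[abs_def] by blast
qed

section \<open>Symmetry of second derivatives\<close>

lemma line_has_field_derivative:
  fixes f :: "'a::real_normed_vector \<Rightarrow> real"
  assumes "f differentiable at (x + s *\<^sub>R a)"
  shows "((\<lambda>s. f (x + s *\<^sub>R a)) has_real_derivative
    frechet_derivative f (at (x + s *\<^sub>R a)) a) (at s)"
proof -
  let ?D = "frechet_derivative f (at (x + s *\<^sub>R a))"
  have D: "(f has_derivative ?D) (at (x + s *\<^sub>R a))"
    using assms by (simp add: frechet_derivative_works)
  have "((\<lambda>s. f (x + s *\<^sub>R a)) has_derivative (\<lambda>h. ?D (h *\<^sub>R a))) (at s)"
    by (rule has_derivative_compose[of "\<lambda>s. x + s *\<^sub>R a" "\<lambda>h. h *\<^sub>R a" s UNIV f ?D, OF _ D])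
      (auto intro!: derivative_eq_intros)
  moreover have "?D (h *\<^sub>R a) = ?D a * h" for h
    using linear_cmul[OF has_derivative_linear[OF D]] by simp
  ultimately show ?thesis by (simp add: has_field_derivative_def)
qed

text \<open>The mean value theorem is applied twice: along \<open>a\<close> to the increment of
  \<open>f\<close> over \<open>h *\<^sub>R b\<close>, then along \<open>b\<close> to the derivative
  of \<open>f\<close> in direction \<open>a\<close>. The double difference does not change when
  \<open>a\<close> and \<open>b\<close> are exchanged.\<close>

lemma double_difference_mean_value:
  fixes f :: "'a::real_normed_vector \<Rightarrow> real"
  assumes "0 < h"
    and S: "\<And>s t. 0 \<le> s \<Longrightarrow> s \<le> h \<Longrightarrow> 0 \<le> t \<Longrightarrow> t \<le> h \<Longrightarrow> x + s *\<^sub>R a + t *\<^sub>R b \<in> S"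
    and f: "\<And>y. y \<in> S \<Longrightarrow> f differentiable at y"
    and f': "\<And>y. y \<in> S \<Longrightarrow> (\<lambda>z. frechet_derivative f (at z) a) differentiable at y"
  obtains s t where "0 < s" "s < h" "0 < t" "t < h"
    "f (x + h *\<^sub>R a + h *\<^sub>R b) - f (x + h *\<^sub>R a) - f (x + h *\<^sub>R b) + f x =
     h * h * frechet_derivative (\<lambda>z. frechet_derivative f (at z) a) (at (x + s *\<^sub>R a + t *\<^sub>R b)) b"
proof -
  let ?Da = "\<lambda>z. frechet_derivative f (at z) a"
  have d1: "((\<lambda>s. f (x + s *\<^sub>R a + h *\<^sub>R b) - f (x + s *\<^sub>R a)) has_real_derivative
     ?Da (x + s *\<^sub>R a + h *\<^sub>R b) - ?Da (x + s *\<^sub>R a)) (at s)" if s: "0 \<le> s" "s \<le> h" for s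
  proof (rule DERIV_diff)
    have "f differentiable at ((x + h *\<^sub>R b) + s *\<^sub>R a)"
      using f[OF S[OF s, of h]] \<open>0 < h\<close> by (simp add: algebra_simps)
    from line_has_field_derivative[OF this]
    show "((\<lambda>s. f (x + s *\<^sub>R a + h *\<^sub>R b)) has_real_derivative ?Da (x + s *\<^sub>R a + h *\<^sub>R b)) (at s)"
      by (simp add: add_ac)
    show "((\<lambda>s. f (x + s *\<^sub>R a)) has_real_derivative ?Da (x + s *\<^sub>R a)) (at s)"
      using f[OF S[OF s, of 0]] \<open>0 < h\<close> by (intro line_has_field_derivative) simp
  qed
  obtain s where s: "0 < s" "s < h" and 1:
    "f (x + h *\<^sub>R a + h *\<^sub>R b) - f (x + h *\<^sub>R a) - (f (x + h *\<^sub>R b) - f x) =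
     h * (?Da (x + s *\<^sub>R a + h *\<^sub>R b) - ?Da (x + s *\<^sub>R a))"
    using MVT2[OF \<open>0 < h\<close> d1] by auto
  have d2: "((\<lambda>t. ?Da (x + s *\<^sub>R a + t *\<^sub>R b)) has_real_derivative
     frechet_derivative ?Da (at (x + s *\<^sub>R a + t *\<^sub>R b)) b) (at t)" if "0 \<le> t" "t \<le> h" for t
    using f'[OF S[of s t]] s that by (intro line_has_field_derivative) simp
  obtain t where t: "0 < t" "t < h" and 2:
    "?Da (x + s *\<^sub>R a + h *\<^sub>R b) - ?Da (x + s *\<^sub>R a) =
     h * frechet_derivative ?Da (at (x + s *\<^sub>R a + t *\<^sub>R b)) b"
    using MVT2[OF \<open>0 < h\<close> d2] by auto
  show ?thesis
    using that[OF s t] 1 2 by simp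
qed

text \<open>Both iterated derivatives, taken at suitable points near \<open>x\<close>, equal the
  same double difference divided by \<open>h * h\<close>. They are continuous, so their values at
  \<open>x\<close> differ by at most any positive \<open>e\<close>.\<close>

lemma directional_derivatives_commute:
  fixes f :: "'a::real_normed_vector \<Rightarrow> real"
  assumes "open S" "x \<in> S" and f: "smooth_on f S"
  shows "frechet_derivative (\<lambda>z. frechet_derivative f (at z) a) (at x) b =
    frechet_derivative (\<lambda>z. frechet_derivative f (at z) b) (at x) a"
proof -
  define P where "P = (\<lambda>a b x. frechet_derivative (\<lambda>z. frechet_derivative f (at z) a) (at x) b)"
  have cont: "isCont (P a b) x" for a b
    using smooth_on_continuous[OF smooth_on_frechet_derivative[OF smooth_on_frechet_derivative[OF f]]]
      assms(1,2) by (auto simp: P_def continuous_on_eq_continuous_at)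
  have "dist (P a b x) (P b a x) \<le> e" if "0 < e" for e
  proof -
    have "eventually (\<lambda>y. y \<in> S \<and> dist (P a b y) (P a b x) < e / 2 \<and> dist (P b a y) (P b a x) < e / 2)
        (nhds x)"
      using cont[of a b] cont[of b a] \<open>0 < e\<close> assms(1,2)
      by (intro eventually_conj eventually_nhds_in_open tendstoD)
        (auto simp: isCont_def tendsto_at_iff_tendsto_nhds)
    then obtain d where "0 < d" and d: "\<And>y. dist y x < d \<Longrightarrow>
        y \<in> S \<and> dist (P a b y) (P a b x) < e / 2 \<and> dist (P b a y) (P b a x) < e / 2"
      unfolding eventually_nhds_metric by blast
    \<comment> \<open>This step size keeps the parallelogram spanned by \<open>h *\<^sub>R a\<close>
      and \<open>h *\<^sub>R b\<close> within distance \<open>d\<close> of \<open>x\<close>; the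
      summand 1 keeps the denominator positive even if both directions are zero.\<close>
    define h where "h = d / (norm a + norm b + 1)"
    have pos: "0 < norm a + norm b + 1"
      using norm_ge_zero[of a] norm_ge_zero[of b] by linarith
    have h: "0 < h"
      using \<open>0 < d\<close> pos by (simp add: h_def)
    have near: "dist (x + s *\<^sub>R a + t *\<^sub>R b) x < d" if "0 \<le> s" "s \<le> h" "0 \<le> t" "t \<le> h" for s t
    proof -
      have "dist (x + s *\<^sub>R a + t *\<^sub>R b) x = norm (s *\<^sub>R a + t *\<^sub>R b)"
        by (simp add: dist_norm algebra_simps)
      also have "\<dots> \<le> s * norm a + t * norm b"
        using norm_triangle_ineq[of "s *\<^sub>R a" "t *\<^sub>R b"] that by simp
      also have "\<dots> \<le> h * norm a + h * norm b"
        using that by (intro add_mono mult_right_mono) auto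
      also have "\<dots> < h * (norm a + norm b + 1)"
        using h by (simp add: algebra_simps)
      also have "\<dots> = d" using pos by (simp add: h_def)
      finally show ?thesis .
    qed
    have near': "dist (x + s *\<^sub>R b + t *\<^sub>R a) x < d" if "0 \<le> s" "s \<le> h" "0 \<le> t" "t \<le> h" for s t
      using near[OF that(3,4,1,2)] by (simp add: add_ac)
    have diff: "f differentiable at y" "(\<lambda>z. frechet_derivative f (at z) v) differentiable at y"
      if "y \<in> S" for y v
      using that f smooth_on_differentiable smooth_on_frechet_derivative by blast+
    obtain s t where st: "0 < s" "s < h" "0 < t" "t < h" and 1:
      "f (x + h *\<^sub>R a + h *\<^sub>R b) - f (x + h *\<^sub>R a) - f (x + h *\<^sub>R b) + f x =
       h * h * P a b (x + s *\<^sub>R a + t *\<^sub>R b)"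
      unfolding P_def
      by (rule double_difference_mean_value[OF h, of x a b S f]) (use d near diff in auto)
    obtain s' t' where st': "0 < s'" "s' < h" "0 < t'" "t' < h" and 2:
      "f (x + h *\<^sub>R b + h *\<^sub>R a) - f (x + h *\<^sub>R b) - f (x + h *\<^sub>R a) + f x =
       h * h * P b a (x + s' *\<^sub>R b + t' *\<^sub>R a)"
      unfolding P_def
      by (rule double_difference_mean_value[OF h, of x b a S f]) (use d near' diff in auto)
    have swap: "x + h *\<^sub>R b + h *\<^sub>R a = x + h *\<^sub>R a + h *\<^sub>R b"
      by (simp add: add_ac)
    have "h * h * P a b (x + s *\<^sub>R a + t *\<^sub>R b) = h * h * P b a (x + s' *\<^sub>R b + t' *\<^sub>R a)"
      using 1 2[unfolded swap] by linarith
    then have "P a b (x + s *\<^sub>R a + t *\<^sub>R b) = P b a (x + s' *\<^sub>R b + t' *\<^sub>R a)"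
      using h by simp
    moreover have "dist (P a b (x + s *\<^sub>R a + t *\<^sub>R b)) (P a b x) < e / 2"
      using d near st by simp
    moreover have "dist (P b a (x + s' *\<^sub>R b + t' *\<^sub>R a)) (P b a x) < e / 2"
      using d near' st' by simp
    ultimately show ?thesis unfolding dist_real_def by linarith
  qed
  then have "dist (P a b x) (P b a x) \<le> 0"
    by (rule field_le_epsilon[of _ 0, simplified])
  then show ?thesis by (simp add: P_def)
qed

lemma partial_commute:
  "open S \<Longrightarrow> x \<in> S \<Longrightarrow> smooth_on f S \<Longrightarrow>
    partial i (partial j f) x = partial j (partial i f) x"
  unfolding partial_def by (rule directional_derivatives_commute)

section \<open>Rules for partial derivatives\<close>

lemma partial_eqI: "(f has_derivative f') (at x) \<Longrightarrow> partial k f x = f' (axis k 1)"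
  unfolding partial_def by (metis frechet_derivative_at)

lemma partial_const [simp]: "partial k (\<lambda>x. c) = (\<lambda>x. 0)"
  by (simp add: partial_def fun_eq_iff)

lemma partial_cmult:
  "f differentiable at x \<Longrightarrow> partial k (\<lambda>x. c * f x) x = c * partial k f x"
  by (subst partial_eqI[OF has_derivative_mult_right])
    (auto simp: partial_def frechet_derivative_works[symmetric])

lemma partial_add:
  "f differentiable at x \<Longrightarrow> g differentiable at x \<Longrightarrow>
    partial k (\<lambda>x. f x + g x) x = partial k f x + partial k g x"
  by (subst partial_eqI[OF has_derivative_add])
    (auto simp: partial_def frechet_derivative_works[symmetric])

lemma partial_sum:
  "(\<And>i. i \<in> I \<Longrightarrow> f i differentiable at x) \<Longrightarrow>
    partial k (\<lambda>x. \<Sum>i\<in>I. f i x) x = (\<Sum>i\<in>I. partial k (f i) x)"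
  by (subst partial_eqI[OF has_derivative_sum])
    (auto simp: partial_def frechet_derivative_works[symmetric])

text \<open>Both functions have the same Frechet derivatives at \<open>x\<close>, so the choice
  behind \<open>frechet_derivative\<close> returns the same map for both, also where neither is
  differentiable.\<close>

lemma partial_cong:
  assumes "open S" "x \<in> S" "\<And>y. y \<in> S \<Longrightarrow> f y = g y"
  shows "partial k f x = partial k g x"
proof -
  have "(f has_derivative f') (at x) \<longleftrightarrow> (g has_derivative f') (at x)" for f'
    using has_derivative_transform_within_open[OF _ assms(1,2)] assms(3) by metis
  then show ?thesis by (simp add: partial_def frechet_derivative_def)
qed

text \<open>The integration step. Linear maps that agree on the axis vectors are equal, so
  \<open>f - g\<close> has zero derivative and is constant on the convex set.\<close>

lemma eq_partials_imp_diff_const: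
  assumes "convex S" and f: "\<And>x. x \<in> S \<Longrightarrow> f differentiable at x"
    and g: "\<And>x. x \<in> S \<Longrightarrow> g differentiable at x"
    and eq: "\<And>k x. x \<in> S \<Longrightarrow> partial k f x = partial k g x"
  shows "\<exists>c. \<forall>x\<in>S. f x = g x + c"
proof -
  have "((\<lambda>x. f x - g x) has_derivative (\<lambda>h. 0)) (at x within S)" if "x \<in> S" for x
  proof -
    let ?f = "frechet_derivative f (at x)" and ?g = "frechet_derivative g (at x)"
    have D: "(f has_derivative ?f) (at x)" "(g has_derivative ?g) (at x)"
      using f g that by (auto simp: frechet_derivative_works[symmetric])
    have "?f b = ?g b" if "b \<in> Basis" for b
      using that eq[OF \<open>x \<in> S\<close>] by (auto simp: Basis_vec_def partial_def)
    then have "?f = ?g"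
      using D by (intro linear_eq_stdbasis has_derivative_linear)
    with has_derivative_diff[OF D] show ?thesis
      by (simp add: has_derivative_at_withinI)
  qed
  from has_derivative_zero_constant[OF assms(1) this]
  obtain c where "\<forall>x\<in>S. f x - g x = c" by blast
  then show ?thesis by (metis add.commute diff_add_cancel)
qed

subsection \<open>Symmetry of the material tensors\<close>

text \<open>The matrix diag(s, s, t). All elements of \<open>Z2_plus_Z2c\<close> have this form with
  entries 1 or -1, which turns invariance into a sign condition on each component.\<close>

definition axial_diag :: "real \<Rightarrow> real \<Rightarrow> real^3^3" where
  "axial_diag s t = (\<chi> i j. if i = j then if i = 3 then t else s else 0)"

lemma axial_diag_sum:
  "(\<Sum>j\<in>UNIV. axial_diag s t$i$j * F j) = (if i = 3 then t else s) * F i"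
proof -
  have "axial_diag s t$i$j * F j = (if j = i then (if i = 3 then t else s) * F i else 0)" for j
    by (simp add: axial_diag_def)
  then show ?thesis by simp
qed

lemma axial_diag_mult: "axial_diag s t ** axial_diag s' t' = axial_diag (s * s') (t * t')"
  by (simp add: matrix_matrix_mult_def vec_eq_iff axial_diag_sum) (simp add: axial_diag_def)

lemma axial_diag_1: "axial_diag 1 1 = mat 1"
  by (simp add: axial_diag_def mat_def vec_eq_iff)

lemma rotation_pi_e3_axial_diag: "rotation_pi_e3 = axial_diag (-1) 1"
  by (simp add: rotation_pi_e3_def axial_diag_def vec_eq_iff forall_3)

lemma minus_mat_1_axial_diag: "- mat 1 = axial_diag (-1) (-1)"
  by (simp add: mat_def axial_diag_def vec_eq_iff)

text \<open>The generators have this form, and it is preserved by products and inverses. Writing the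
  sign condition as \<open>s * s = 1\<close> makes closure under products plain algebra.\<close>

lemma Z2_plus_Z2c_imp_axial_diag:
  assumes "Q \<in> Z2_plus_Z2c"
  shows "\<exists>s t. s * s = 1 \<and> t * t = 1 \<and> Q = axial_diag s t"
  using assms unfolding Z2_plus_Z2c_def
proof (induction rule: generate.induct)
  case one
  then show ?case by (auto simp: O3_def axial_diag_1[symmetric] intro!: exI[of _ 1])
next
  case (incl h)
  then have "\<exists>t\<in>{1, -1}. h = axial_diag (-1) t"
    unfolding rotation_pi_e3_axial_diag minus_mat_1_axial_diag by auto
  then obtain t where "t \<in> {1, -1}" "h = axial_diag (-1) t" by blast
  then show ?case by (intro exI[of _ "-1"] exI[of _ t]) auto
next
  case (inv h)
  then obtain s t where h: "h = axial_diag s t" "s * s = 1" "t * t = 1"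
    unfolding rotation_pi_e3_axial_diag minus_mat_1_axial_diag by force
  \<comment> \<open>A symmetric matrix whose square is the identity is orthogonal and its own
    inverse.\<close>
  have "transpose h = h" by (simp add: h axial_diag_def transpose_def vec_eq_iff)
  moreover have "h ** h = mat 1" by (simp add: h axial_diag_mult axial_diag_1)
  ultimately have "inv\<^bsub>O3\<^esub> h = h"
    by (intro group.inv_equality[OF group_O3]) (auto simp: O3_def orthogonal_matrix_def)
  with h show ?case by blast
next
  case (eng h1 h2)
  then obtain s t s' t' where "s * s = 1" "t * t = 1" "h1 = axial_diag s t"
    "s' * s' = 1" "t' * t' = 1" "h2 = axial_diag s' t'" by blast
  then show ?case
    by (intro exI[of _ "s * s'"] exI[of _ "t * t'"])
      (simp add: O3_def axial_diag_mult mult_ac)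
qed

lemma axial_diag_sum4:
  fixes T :: tensor4
  shows "(\<Sum>j1\<in>UNIV. \<Sum>j2\<in>UNIV. \<Sum>j3\<in>UNIV. \<Sum>j4\<in>UNIV.
      axial_diag s t$i1$j1 * axial_diag s t$i2$j2 * axial_diag s t$i3$j3 * axial_diag s t$i4$j4
        * T j1 j2 j3 j4) =
    (if i1 = 3 then t else s) * (if i2 = 3 then t else s) * (if i3 = 3 then t else s) *
    (if i4 = 3 then t else s) * T i1 i2 i3 i4"
  by (simp only: mult.assoc sum_distrib_left[symmetric] axial_diag_sum)

lemma invariant4_axial_diag:
  assumes "invariant4 G T" "axial_diag s t \<in> G"
  shows "(if i = 3 then t else s) * (if j = 3 then t else s) * (if l = 3 then t else s) *
    (if m = 3 then t else s) * T i j l m = T i j l m"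
  by (rule trans[OF axial_diag_sum4[symmetric]
        bspec[OF assms(1)[unfolded invariant4_def] assms(2), rule_format]])

text \<open>The rotation by \<pi> about $e_3$ changes the sign once for each index different from 3.
  Among four indices, that number is odd exactly when the number of indices equal to 3 is odd; such
  a component equals its own negative.\<close>

lemma monoclinic_odd_C_eq_0:
  assumes "(C, M, A) \<in> monoclinic_Z2_minus"
    and "odd (of_bool (i = 3) + of_bool (j = 3) + of_bool (l = 3) + of_bool (m = 3) :: nat)"
  shows "C i j l m = 0"
proof -
  have "axial_diag (-1) 1 \<in> Z2_plus_Z2c"
    unfolding Z2_plus_Z2c_def rotation_pi_e3_axial_diag[symmetric] by (rule generate.incl) simp
  moreover have "invariant4 Z2_plus_Z2c C"
    using assms(1) by (simp add: monoclinic_Z2_minus_def)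
  ultimately have "(if i = 3 then 1 else -1) * (if j = 3 then 1 else -1) * (if l = 3 then 1 else -1) *
      (if m = 3 then 1 else -1) * C i j l m = C i j l m"
    using invariant4_axial_diag by blast
  then show ?thesis using assms(2) by (auto split: if_splits)
qed

section \<open>Elastic test materials\<close>

definition sym_prod :: "(3 \<Rightarrow> 3 \<Rightarrow> real) \<Rightarrow> (3 \<Rightarrow> 3 \<Rightarrow> real) \<Rightarrow> tensor4" where
  "sym_prod P R i j l m = P i j * R l m + R i j * P l m"

text \<open>The disjunction, in place of a sum of two matrix units, gives the entry 1 rather than 2
  when \<open>a = b\<close>.\<close>

definition sym_unit :: "3 \<Rightarrow> 3 \<Rightarrow> 3 \<Rightarrow> 3 \<Rightarrow> real" where
  "sym_unit a b i j = of_bool (i = a \<and> j = b \<or> i = b \<and> j = a)"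

text \<open>The condition \<open>parity\<close> says that every nonzero component of the product has
  an even number of indices 3, so the signs coming from diag(s, s, t) cancel. Symmetry of the two
  factors gives the index symmetries.\<close>

lemma elastic_in_monoclinic:
  assumes P: "\<And>i j. P i j = P j i" and R: "\<And>i j. R i j = R j i"
    and parity: "\<And>i j l m. P i j \<noteq> 0 \<Longrightarrow> R l m \<noteq> 0 \<Longrightarrow> (i = 3 \<longleftrightarrow> j = 3) \<longleftrightarrow> (l = 3 \<longleftrightarrow> m = 3)"
  shows "(sym_prod P R, (\<lambda>_ _ _ _ _. 0), (\<lambda>_ _ _ _ _ _. 0)) \<in> monoclinic_Z2_minus"
proof -
  have "strain_gradient_material (sym_prod P R, (\<lambda>_ _ _ _ _. 0), (\<lambda>_ _ _ _ _ _. 0))"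
    unfolding strain_gradient_material_def sym_prod_def
    by (simp add: P R mult_ac add_ac)
  moreover have "invariant4 Z2_plus_Z2c (sym_prod P R)"
    unfolding invariant4_def
  proof (intro ballI allI)
    fix Q :: "real^3^3" and i1 i2 i3 i4
    assume "Q \<in> Z2_plus_Z2c"
    then obtain s t where st: "s * s = 1" "t * t = 1" "Q = axial_diag s t"
      using Z2_plus_Z2c_imp_axial_diag by blast
    define d where "d = (\<lambda>i::3. if i = 3 then t else s)"
    \<comment> \<open>With zero, two or four indices equal to 3 the product of signs is a product of
      the squares \<open>s * s\<close> and \<open>t * t\<close>.\<close>
    have d: "d i * d j * d l * d m * X = X" if "(i = 3 \<longleftrightarrow> j = 3) \<longleftrightarrow> (l = 3 \<longleftrightarrow> m = 3)"
      for i j l m X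
    proof -
      have "d i * d j * d l * d m = (s * s) * (s * s) \<or> d i * d j * d l * d m = (t * t) * (t * t) \<or>
          d i * d j * d l * d m = (s * s) * (t * t)"
        using that by (auto simp: d_def mult_ac split: if_splits)
      with st show ?thesis by auto
    qed
    have "d i1 * d i2 * d i3 * d i4 * sym_prod P R i1 i2 i3 i4 = sym_prod P R i1 i2 i3 i4"
    proof (cases "(i1 = 3 \<longleftrightarrow> i2 = 3) \<longleftrightarrow> (i3 = 3 \<longleftrightarrow> i4 = 3)")
      case False
      then have "P i1 i2 = 0 \<or> R i3 i4 = 0" "P i3 i4 = 0 \<or> R i1 i2 = 0"
        using parity by blast+
      then show ?thesis by (auto simp: sym_prod_def)
    qed (rule d)
    then show "(\<Sum>j1\<in>UNIV. \<Sum>j2\<in>UNIV. \<Sum>j3\<in>UNIV. \<Sum>j4\<in>UNIV.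
        Q$i1$j1 * Q$i2$j2 * Q$i3$j3 * Q$i4$j4 * sym_prod P R j1 j2 j3 j4) = sym_prod P R i1 i2 i3 i4"
      unfolding st(3) axial_diag_sum4 d_def by simp
  qed
  ultimately show ?thesis
    by (simp add: monoclinic_Z2_minus_def invariant5_def invariant6_def)
qed

subsection \<open>Equilibrium and the strain gradient\<close>

text \<open>The strain gradient $e_{lm,n}$ of \<open>torsion_field 2\<close>; it spans the common
  kernel of the equations from the elastic test materials.\<close>

definition twist :: "3 \<Rightarrow> 3 \<Rightarrow> 3 \<Rightarrow> real" where
  "twist l m n =
     (if (l, m, n) \<in> {(1, 3, 2), (3, 1, 2)} then 1
      else if (l, m, n) \<in> {(2, 3, 1), (3, 2, 1)} then -1 else 0)"

text \<open>Each cross-section at height $x_3$ undergoes the infinitesimal rotation by the angle $-c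
  x_3$ about $e_3$.\<close>

definition torsion_field :: "real \<Rightarrow> real^3 \<Rightarrow> real^3" where
  "torsion_field c x = vector [c * x$2 * x$3, - c * x$1 * x$3, 0]"

lemma differentiable_vec_nth: "(\<lambda>x::real^3. x $ k) differentiable at x"
  by (rule bounded_linear_imp_differentiable[OF bounded_linear_vec_nth])

lemma partial_linear_form: "partial k (\<lambda>x. \<Sum>j\<in>UNIV. a j * x$j) x = a k"
proof -
  have "((\<lambda>x::real^3. \<Sum>j\<in>UNIV. a j * x$j) has_derivative (\<lambda>h. \<Sum>j\<in>UNIV. a j * h$j)) (at x)"
    by (intro has_derivative_sum has_derivative_mult_right bounded_linear_imp_has_derivative
        bounded_linear_vec_nth)
  from partial_eqI[OF this] show ?thesis
    by (simp add: axis_def if_distrib[of "\<lambda>t. _ * t"] cong: if_cong)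
qed

lemma torsion_field_component_has_derivative:
  "((\<lambda>x. torsion_field c x $ i) has_derivative
    (\<lambda>h. vector [c * (x$2 * h$3 + h$2 * x$3), - c * (x$1 * h$3 + h$1 * x$3), 0] $ i)) (at x)"
proof -
  have nth: "((\<lambda>x::real^3. x $ k) has_derivative (\<lambda>h. h $ k)) (at x)" for k
    by (intro bounded_linear_imp_has_derivative bounded_linear_vec_nth)
  show ?thesis
    using exhaust_3[of i]
    by (auto simp: torsion_field_def algebra_simps intro!: derivative_eq_intros nth)
qed

text \<open>The field is quadratic, so its first derivatives are linear forms. Their coefficients
  are written as $e_{ij,k} + e_{ik,j} - e_{jk,i}$ to match
  \<open>second_partials_from_strain\<close>.\<close>

lemma partial_torsion_field:
  "partial j (\<lambda>x. torsion_field c x $ i) x =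
    (\<Sum>k\<in>UNIV. c / 2 * (twist i j k + twist i k j - twist j k i) * x$k)"
  unfolding partial_eqI[OF torsion_field_component_has_derivative]
  using exhaust_3[of i] exhaust_3[of j]
  by (elim disjE) (simp_all add: sum_3 twist_def axis_def)

lemma partial_strain:
  assumes "open \<Omega>" "smooth_on u \<Omega>" "x \<in> \<Omega>"
  shows "partial n (strain u l m) x =
    (partial n (partial m (\<lambda>y. u y $ l)) x + partial n (partial l (\<lambda>y. u y $ m)) x) / 2"
proof -
  have diff: "partial i (\<lambda>y. u y $ j) differentiable at x" for i j
    using assms smooth_on_differentiable smooth_on_partial smooth_on_component by blast
  have "strain u l m = (\<lambda>x. (1/2) * (partial m (\<lambda>y. u y $ l) x + partial l (\<lambda>y. u y $ m) x))"
    by (simp add: strain_def fun_eq_iff)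
  then show ?thesis
    using diff by (simp add: partial_cmult partial_add del: times_divide_eq_left)
qed

text \<open>After expansion, the second derivatives of \<open>u $ j\<close> and \<open>u $ k\<close>
  cancel because mixed partials commute, and the two halves of $u_{i,jk}$ add up.\<close>

lemma second_partials_from_strain:
  assumes "open \<Omega>" "smooth_on u \<Omega>" "x \<in> \<Omega>"
  shows "partial k (partial j (\<lambda>y. u y $ i)) x =
    partial k (strain u i j) x + partial j (strain u i k) x - partial i (strain u j k) x"
  using partial_commute[OF assms(1,3) smooth_on_component[OF assms(1,2)]]
  unfolding partial_strain[OF assms] by (simp add: field_simps)

section \<open>The pointwise linear system for the strain gradient\<close>

lemma elastic_equilibrium:
  assumes "open \<Omega>" "smooth_on u \<Omega>" "x \<in> \<Omega>"
    and "equilibrium \<Omega> (C, (\<lambda>_ _ _ _ _. 0), (\<lambda>_ _ _ _ _ _. 0)) u"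
  shows "(\<Sum>j\<in>UNIV. \<Sum>l\<in>UNIV. \<Sum>m\<in>UNIV. C i j l m * partial j (strain u l m) x) = 0"
proof -
  have "strain u l m differentiable at x" for l m
    using assms(1-3) smooth_on_differentiable smooth_on_strain by blast
  then have "partial j (stress C (\<lambda>_ _ _ _ _. 0) u i j) x =
      (\<Sum>l\<in>UNIV. \<Sum>m\<in>UNIV. C i j l m * partial j (strain u l m) x)" for j
    unfolding stress_def[abs_def] by (simp add: partial_sum partial_cmult)
  moreover have "hyperstress (\<lambda>_ _ _ _ _. 0) (\<lambda>_ _ _ _ _ _. 0) u i j k = (\<lambda>x. 0)" for j k
    by (simp add: hyperstress_def[abs_def])
  moreover have "(\<Sum>j\<in>UNIV. partial j (stress C (\<lambda>_ _ _ _ _. 0) u i j) x) -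
      (\<Sum>j\<in>UNIV. \<Sum>k\<in>UNIV. partial k (partial j
        (hyperstress (\<lambda>_ _ _ _ _. 0) (\<lambda>_ _ _ _ _ _. 0) u i j k)) x) = 0"
    using assms(3,4) unfolding equilibrium_def by blast
  ultimately show ?thesis by simp
qed

lemma elastic_kernel:
  assumes sym: "\<And>l m n. E l m n = E m l n"
    and eq: "\<And>P R i. \<lbrakk>\<And>i j. P i j = P j i; \<And>i j. R i j = R j i;
        \<And>i j l m. P i j \<noteq> 0 \<Longrightarrow> R l m \<noteq> 0 \<Longrightarrow> (i = 3 \<longleftrightarrow> j = 3) \<longleftrightarrow> (l = 3 \<longleftrightarrow> m = 3)\<rbrakk> \<Longrightarrow>
        (\<Sum>j\<in>UNIV. \<Sum>l\<in>UNIV. \<Sum>m\<in>UNIV. sym_prod P R i j l m * E l m j) = (0::real)"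
  shows "E l m n = E 1 3 2 * twist l m n"
proof -
  have sym': "E 2 1 n = E 1 2 n" "E 3 1 n = E 1 3 n" "E 3 2 n = E 2 3 n" for n
    using sym by auto
  have eq': "(\<Sum>j\<in>UNIV. \<Sum>l\<in>UNIV. \<Sum>m\<in>UNIV.
      sym_prod (sym_unit a b) (sym_unit c d) i j l m * E l m j) = 0"
    if "(a = 3 \<longleftrightarrow> b = 3) \<longleftrightarrow> (c = 3 \<longleftrightarrow> d = 3)" for a b c d i
    by (rule eq) (use that in \<open>auto simp: sym_unit_def\<close>)
  note eqs = sum_3 sym_prod_def sym_unit_def sym'
  \<comment> \<open>In \<open>eq'\<close> the first four numbers choose the two units and the last
    one is the free index \<open>i\<close> of the equation.\<close>
  have diag: "E 1 1 1 = 0" "E 2 2 2 = 0" "E 3 3 3 = 0"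
    using eq'[of 1 1 1 1 1] eq'[of 2 2 2 2 2] eq'[of 3 3 3 3 3] by (simp_all add: eqs)
  \<comment> \<open>With two different diagonal units, \<open>i\<close> selects which factor
    survives: the units (1,1) and (2,2) give \<open>E 2 2 1\<close> for \<open>i = 1\<close> and
    \<open>E 1 1 2\<close> for \<open>i = 2\<close>.\<close>
  have 1: "E 2 2 1 = 0" "E 1 1 2 = 0" "E 3 3 1 = 0" "E 1 1 3 = 0" "E 3 3 2 = 0" "E 2 2 3 = 0"
    using eq'[of 1 1 2 2 1] eq'[of 1 1 2 2 2] eq'[of 1 1 3 3 1] eq'[of 1 1 3 3 3]
      eq'[of 2 2 3 3 2] eq'[of 2 2 3 3 3] by (simp_all add: eqs)
  have 2: "E 1 2 1 = 0" "E 1 2 2 = 0" "E 1 2 3 = 0"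
    using eq'[of 1 2 1 2 1] eq'[of 1 2 1 2 2] eq'[of 3 3 1 2 3] by (simp_all add: eqs)
  \<comment> \<open>The last instance is the only one to couple two components: for
    \<open>i = 3\<close> the units (1,3) and (2,3) contribute \<open>E 2 3 1\<close> and
    \<open>E 1 3 2\<close> to one equation. This leaves the single free parameter.\<close>
  have 3: "E 1 3 1 = 0" "E 1 3 3 = 0" "E 2 3 2 = 0" "E 2 3 3 = 0" "E 2 3 1 = - E 1 3 2"
    using eq'[of 1 3 1 3 1] eq'[of 1 3 1 3 3] eq'[of 2 3 2 3 2] eq'[of 2 3 2 3 3]
      eq'[of 1 3 2 3 3] by (simp_all add: eqs)
  show ?thesis
    using exhaust_3[of l] exhaust_3[of m] exhaust_3[of n]
    by (elim disjE) (simp_all add: twist_def diag 1 2 3 sym')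
qed

text \<open>Under a constant strain gradient the triple sum is constant on \<Omega> and
  differentiates to zero. General coefficients \<open>T\<close> and \<open>W\<close> let the formula
  serve both the stress and the hyper-stress.\<close>

lemma partial_affine_stress:
  assumes "open \<Omega>" "smooth_on u \<Omega>" "x \<in> \<Omega>"
    and E: "\<And>l m n y. y \<in> \<Omega> \<Longrightarrow> partial n (strain u l m) y = E l m n"
  shows "partial p (\<lambda>x. (\<Sum>l\<in>UNIV. \<Sum>m\<in>UNIV. T l m * strain u l m x) +
      (\<Sum>l\<in>UNIV. \<Sum>m\<in>UNIV. \<Sum>n\<in>UNIV. W l m n * partial n (strain u l m) x)) x =
    (\<Sum>l\<in>UNIV. \<Sum>m\<in>UNIV. T l m * E l m p)"
proof -
  have diff: "strain u l m differentiable at x" for l m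
    using assms(1-3) smooth_on_differentiable smooth_on_strain by blast
  have "partial p (\<lambda>x. (\<Sum>l\<in>UNIV. \<Sum>m\<in>UNIV. T l m * strain u l m x) +
      (\<Sum>l\<in>UNIV. \<Sum>m\<in>UNIV. \<Sum>n\<in>UNIV. W l m n * partial n (strain u l m) x)) x =
    partial p (\<lambda>x. (\<Sum>l\<in>UNIV. \<Sum>m\<in>UNIV. T l m * strain u l m x) +
      (\<Sum>l\<in>UNIV. \<Sum>m\<in>UNIV. \<Sum>n\<in>UNIV. W l m n * E l m n)) x"
    by (rule partial_cong[OF assms(1,3)]) (simp add: E)
  also have "\<dots> = (\<Sum>l\<in>UNIV. \<Sum>m\<in>UNIV. T l m * E l m p)"
    using diff E[OF assms(3)] by (simp add: partial_add partial_sum partial_cmult)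
  finally show ?thesis .
qed

text \<open>The first derivatives of the hyper-stress are constant, so its second derivatives
  vanish, and the part of the stress coming from \<open>M\<close> is constant. Only the condition on
  \<open>C\<close> remains.\<close>

lemma constant_strain_gradient_equilibrium:
  assumes "open \<Omega>" "smooth_on u \<Omega>"
    and E: "\<And>l m n y. y \<in> \<Omega> \<Longrightarrow> partial n (strain u l m) y = E l m n"
    and C: "\<And>i. (\<Sum>j\<in>UNIV. \<Sum>l\<in>UNIV. \<Sum>m\<in>UNIV. C i j l m * E l m j) = 0"
  shows "equilibrium \<Omega> (C, M, A) u"
proof -
  have "partial k (partial j (hyperstress M A u i j k)) x = 0" if "x \<in> \<Omega>" for i j k x
  proof -
    have "partial k (partial j (hyperstress M A u i j k)) x =
        partial k (\<lambda>_. \<Sum>l\<in>UNIV. \<Sum>m\<in>UNIV. M l m i j k * E l m j) x"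
      unfolding hyperstress_def[abs_def]
      by (rule partial_cong[OF assms(1) that partial_affine_stress[OF assms(1,2) _ E]])
    then show ?thesis by simp
  qed
  moreover have "partial j (stress C M u i j) x = (\<Sum>l\<in>UNIV. \<Sum>m\<in>UNIV. C i j l m * E l m j)"
    if "x \<in> \<Omega>" for i j x
    unfolding stress_def[abs_def] by (rule partial_affine_stress[OF assms(1,2) that E])
  ultimately show ?thesis
    using C by (simp add: equilibrium_def)
qed

text \<open>By the minor symmetries the contraction is a multiple of
  \<open>C i 2 1 3 - C i 1 2 3\<close>.\<close>

lemma twist_elastic_equilibrium:
  assumes "(C, M, A) \<in> monoclinic_Z2_minus"
  shows "(\<Sum>j\<in>UNIV. \<Sum>l\<in>UNIV. \<Sum>m\<in>UNIV. C i j l m * (k * twist l m j)) = 0"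
proof -
  have sym: "C i j l m = C j i l m" "C i j l m = C l m i j" for i j l m
    using assms unfolding monoclinic_Z2_minus_def strain_gradient_material_def by blast+
  have "C i 2 1 3 = C i 1 2 3"
  \<comment> \<open>For \<open>i = 3\<close> the major symmetry exchanges the pairs (2,3) and (1,3).
    For other \<open>i\<close> both components contain exactly one index 3 and vanish by
    parity.\<close>
  proof (cases "i = 3")
    case True
    then show ?thesis by (metis sym)
  next
    case False
    then show ?thesis by (simp add: monoclinic_odd_C_eq_0[OF assms])
  qed
  moreover have "C i j l m = C i j m l" for i j l m by (metis sym)
  then have "C i 2 3 1 = C i 2 1 3" "C i 1 3 2 = C i 1 2 3" by blast+
  ultimately show ?thesis
    by (simp add: sum_3 twist_def)
qed

text \<open>This expresses $u_{l,mn} + u_{m,ln} = 2 e_{lm,n}$ for the second derivatives built from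
  \<open>twist\<close>.\<close>

lemma twist_symmetrized:
  "(twist l m n + twist l n m - twist m n l) + (twist m l n + twist m n l - twist l n m) = 2 * twist l m n"
  using exhaust_3[of l] exhaust_3[of m] exhaust_3[of n]
  by (elim disjE) (simp_all add: twist_def)

lemma torsion_field_differentiable: "(\<lambda>x. torsion_field c x $ i) differentiable at x"
  using torsion_field_component_has_derivative by (auto simp: differentiable_def)

lemma linear_form_differentiable: "(\<lambda>x::real^3. \<Sum>j\<in>UNIV. a j * x$j) differentiable at x"
  by (auto intro!: differentiable_sum differentiable_mult simp: differentiable_vec_nth)

lemma partial_affine_plus_torsion:
  "partial j (\<lambda>x. ((\<Sum>j\<in>UNIV. H i j * x$j) + b) + torsion_field c x $ i) x =
    (\<Sum>k\<in>UNIV. c / 2 * (twist i j k + twist i k j - twist j k i) * x$k) + H i j"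
  by (simp add: partial_add linear_form_differentiable torsion_field_differentiable
      partial_linear_form partial_torsion_field)

section \<open>Integration of the strain gradient and the converse\<close>

lemma universal_imp_torsion:
  assumes "\<Omega> \<noteq> {}" "open \<Omega>" "convex \<Omega>" and u: "smooth_on u \<Omega>"
    and univ: "universal_for \<Omega> monoclinic_Z2_minus u"
  shows "\<exists>(H::real^3^3) b c. \<forall>x\<in>\<Omega>. u x = H *v x + b + torsion_field c x"
proof -
  note e_smooth = smooth_on_strain[OF assms(2) u]
  \<comment> \<open>The free parameter of the kernel, as a function of the point.\<close>
  define \<kappa> where "\<kappa> = partial 2 (strain u 1 3)"
  have E: "partial n (strain u l m) x = \<kappa> x * twist l m n" if "x \<in> \<Omega>" for l m n x
    unfolding \<kappa>_def
  proof (rule elastic_kernel)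
    show "partial n (strain u l m) x = partial n (strain u m l) x" for l m n
      by (simp add: strain_def[abs_def] add.commute)
  qed (use elastic_in_monoclinic elastic_equilibrium[OF assms(2) u that] univ in
      \<open>auto simp: universal_for_def\<close>)
  have mixed: "partial i (partial j (strain u l m)) x = 0"
    if "x \<in> \<Omega>" "twist l m i = 0" for i j l m x
  proof -
    have "partial i (partial j (strain u l m)) x = partial j (partial i (strain u l m)) x"
      by (rule partial_commute[OF assms(2) that(1) e_smooth])
    also have "\<dots> = partial j (\<lambda>_. 0) x"
      by (rule partial_cong[OF assms(2) that(1)]) (simp add: E that(2))
    finally show ?thesis by simp
  qed
  \<comment> \<open>For \<open>k\<close> other than 2, \<open>mixed\<close> applies directly because
    \<open>twist 1 3 k = 0\<close>. For \<open>k = 2\<close> the identity $e_{13,2} = -e_{23,1}$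
    moves the question to $e_{23}$, where \<open>twist 2 3 2 = 0\<close>.\<close>
  have d0: "partial k \<kappa> x = partial k (\<lambda>_. 0) x" if x: "x \<in> \<Omega>" for k x
  proof (cases "k = 2")
    case False
    then show ?thesis
      using mixed[OF x, of 1 3 k 2] by (simp add: \<kappa>_def twist_def)
  next
    case True
    have "partial 2 \<kappa> x = partial 2 (\<lambda>x. -1 * partial 1 (strain u 2 3) x) x"
      by (rule partial_cong[OF assms(2) x]) (simp add: E twist_def)
    also have "\<dots> = -1 * partial 2 (partial 1 (strain u 2 3)) x"
      by (rule partial_cmult[OF smooth_on_differentiable[OF smooth_on_partial[OF e_smooth] x]])
    also have "\<dots> = 0"
      using mixed[OF x, of 2 3 2 1] by (simp add: twist_def)
    finally show ?thesis using True by simp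
  qed
  have "\<exists>k. \<forall>x\<in>\<Omega>. \<kappa> x = 0 + k"
  proof (rule eq_partials_imp_diff_const[OF assms(3) _ differentiable_const d0])
    show "\<kappa> differentiable at x" if "x \<in> \<Omega>" for x
      unfolding \<kappa>_def by (rule smooth_on_differentiable[OF smooth_on_partial[OF e_smooth] that])
  qed
  then obtain k where k: "\<And>x. x \<in> \<Omega> \<Longrightarrow> \<kappa> x = 0 + k" by blast
  \<comment> \<open>The strain gradient of \<open>torsion_field c\<close> is
    \<open>c / 2 * twist\<close>, hence the factor 2.\<close>
  define c where "c = 2 * k"
  have ui: "smooth_on (\<lambda>x. u x $ i) \<Omega>" for i
    by (rule smooth_on_component[OF assms(2) u])
  have "\<exists>h. \<forall>x\<in>\<Omega>. partial j (\<lambda>x. u x $ i) x =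
      (\<Sum>k\<in>UNIV. c / 2 * (twist i j k + twist i k j - twist j k i) * x$k) + h" for i j
  proof (rule eq_partials_imp_diff_const[OF assms(3)])
    fix x assume x: "x \<in> \<Omega>"
    show "partial j (\<lambda>x. u x $ i) differentiable at x"
      by (rule smooth_on_differentiable[OF smooth_on_partial[OF ui] x])
    show "(\<lambda>x::real^3. \<Sum>k\<in>UNIV. c / 2 * (twist i j k + twist i k j - twist j k i) * x$k)
        differentiable at x"
      by (rule linear_form_differentiable)
    show "partial l (partial j (\<lambda>x. u x $ i)) x =
        partial l (\<lambda>x. \<Sum>k\<in>UNIV. c / 2 * (twist i j k + twist i k j - twist j k i) * x$k) x" for l
      unfolding second_partials_from_strain[OF assms(2) u x] partial_linear_form
      by (simp add: E x k c_def algebra_simps)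
  qed
  then have "\<forall>i. \<exists>h. \<forall>j. \<forall>x\<in>\<Omega>. partial j (\<lambda>x. u x $ i) x =
      (\<Sum>k\<in>UNIV. c / 2 * (twist i j k + twist i k j - twist j k i) * x$k) + h j"
    by (intro allI choice) blast
  from choice[OF this] obtain H where H: "\<And>i j x. x \<in> \<Omega> \<Longrightarrow> partial j (\<lambda>x. u x $ i) x =
      (\<Sum>k\<in>UNIV. c / 2 * (twist i j k + twist i k j - twist j k i) * x$k) + H i j"
    by blast
  \<comment> \<open>The summand 0 fills the slot of the constant in
    \<open>partial_affine_plus_torsion\<close>; the actual constant of integration is
    \<open>b\<close>.\<close>
  have "\<exists>b. \<forall>x\<in>\<Omega>. u x $ i = ((\<Sum>j\<in>UNIV. H i j * x$j) + 0) + torsion_field c x $ i + b" for i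
  proof (rule eq_partials_imp_diff_const[OF assms(3)])
    fix x assume x: "x \<in> \<Omega>"
    show "(\<lambda>x. u x $ i) differentiable at x"
      by (rule smooth_on_differentiable[OF ui x])
    show "(\<lambda>x. ((\<Sum>j\<in>UNIV. H i j * x$j) + 0) + torsion_field c x $ i) differentiable at x"
      by (intro differentiable_add linear_form_differentiable torsion_field_differentiable) simp
    show "partial j (\<lambda>x. u x $ i) x =
        partial j (\<lambda>x. ((\<Sum>j\<in>UNIV. H i j * x$j) + 0) + torsion_field c x $ i) x" for j
      unfolding H[OF x] partial_affine_plus_torsion ..
  qed
  then have "\<forall>i. \<exists>b. \<forall>x\<in>\<Omega>.
      u x $ i = ((\<Sum>j\<in>UNIV. H i j * x$j) + 0) + torsion_field c x $ i + b" by blast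
  from choice[OF this] obtain b where b: "\<And>i x. x \<in> \<Omega> \<Longrightarrow>
      u x $ i = ((\<Sum>j\<in>UNIV. H i j * x$j) + 0) + torsion_field c x $ i + b i"
    by blast
  have "u x = (\<chi> i j. H i j) *v x + (\<chi> i. b i) + torsion_field c x" if "x \<in> \<Omega>" for x
    by (simp add: vec_eq_iff b[OF that] matrix_vector_mult_def)
  then show ?thesis by blast
qed

text \<open>The affine part has no second derivatives, so the strain gradient is the constant tensor
  \<open>c / 2 * twist\<close>, whose contraction with every admissible \<open>C\<close>
  vanishes.\<close>

lemma torsion_imp_universal:
  assumes "open \<Omega>" and u: "smooth_on u \<Omega>"
    and eq: "\<And>x. x \<in> \<Omega> \<Longrightarrow> u x = (H::real^3^3) *v x + b + torsion_field c x"
  shows "universal_for \<Omega> monoclinic_Z2_minus u"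
proof -
  have du: "partial j (\<lambda>x. u x $ i) x =
      (\<Sum>k\<in>UNIV. c / 2 * (twist i j k + twist i k j - twist j k i) * x$k) + H $ i $ j"
    if "x \<in> \<Omega>" for i j x
  proof -
    have "partial j (\<lambda>x. u x $ i) x =
        partial j (\<lambda>x. ((\<Sum>j\<in>UNIV. H $ i $ j * x$j) + b $ i) + torsion_field c x $ i) x"
      by (rule partial_cong[OF assms(1) that]) (simp add: eq matrix_vector_mult_def)
    then show ?thesis
      by (simp only: partial_affine_plus_torsion[of j "\<lambda>i j. H $ i $ j" i "b $ i" c x])
  qed
  have ddu: "partial n (partial j (\<lambda>x. u x $ i)) x = c / 2 * (twist i j n + twist i n j - twist j n i)"
    if "x \<in> \<Omega>" for i j n x
  proof -
    have "partial n (partial j (\<lambda>x. u x $ i)) x = partial n (\<lambda>x.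
        (\<Sum>k\<in>UNIV. c / 2 * (twist i j k + twist i k j - twist j k i) * x$k) + H $ i $ j) x"
      by (rule partial_cong[OF assms(1) that du])
    then show ?thesis
      by (simp only: partial_add linear_form_differentiable differentiable_const partial_linear_form
          partial_const add_0_right)
  qed
  have "partial n (strain u l m) x = c / 2 * twist l m n" if "x \<in> \<Omega>" for l m n x
  proof -
    \<comment> \<open>One half comes from the definition of strain, the other from the coefficient
      \<open>c / 2\<close>; symmetrization restores a factor 2.\<close>
    have "partial n (strain u l m) x = c / 4 *
        ((twist l m n + twist l n m - twist m n l) + (twist m l n + twist m n l - twist l n m))"
      by (simp add: partial_strain[OF assms(1) u that] ddu[OF that] field_simps)
    then show ?thesis unfolding twist_symmetrized by simp
  qed
  then have "equilibrium \<Omega> (C, M, A) u" if "(C, M, A) \<in> monoclinic_Z2_minus" for C M A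
    by (rule constant_strain_gradient_equilibrium[OF assms(1) u _ twist_elastic_equilibrium[OF that]])
  then show ?thesis by (auto simp: universal_for_def)
qed

theorem proposition3p5:
  fixes \<Omega> :: "(real^3) set" and u :: "real^3 \<Rightarrow> real^3"
  assumes "\<Omega> \<noteq> {}" and "open \<Omega>" and "convex \<Omega>"
    and "displacement_field \<Omega> u"
  shows "universal_for \<Omega> monoclinic_Z2_minus u \<longleftrightarrow>
    (\<exists>v c. homogeneous_field \<Omega> v \<and>
       (\<forall>x\<in>\<Omega>. u x = v x + vector [c * x$2 * x$3, - c * x$1 * x$3, 0]))"
proof -
  have u: "smooth_on u \<Omega>"
    using assms(4) by (simp add: displacement_field_def smooth_on_def)
  show ?thesis
  proof
    assume "universal_for \<Omega> monoclinic_Z2_minus u"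
    from universal_imp_torsion[OF assms(1-3) u this] obtain H b c
      where "\<forall>x\<in>\<Omega>. u x = H *v x + b + torsion_field c x" by blast
    then show "\<exists>v c. homogeneous_field \<Omega> v \<and>
        (\<forall>x\<in>\<Omega>. u x = v x + vector [c * x$2 * x$3, - c * x$1 * x$3, 0])"
      unfolding homogeneous_field_def torsion_field_def
      by (intro exI[of _ "\<lambda>x. H *v x + b"] exI[of _ c]) blast
  next
    assume "\<exists>v c. homogeneous_field \<Omega> v \<and>
        (\<forall>x\<in>\<Omega>. u x = v x + vector [c * x$2 * x$3, - c * x$1 * x$3, 0])"
    then obtain H b c where "\<And>x. x \<in> \<Omega> \<Longrightarrow> u x = H *v x + b + torsion_field c x"
      unfolding homogeneous_field_def torsion_field_def by metis
    then show "universal_for \<Omega> monoclinic_Z2_minus u"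
      by (rule torsion_imp_universal[OF assms(2) u])
  qed
qed

end
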